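(* Let $G$ be a $2$-connected nontrivial uniquely $C_9$-saturated graph, let $C=[c_0,c_1,\dots,c_5]$ (indices modulo $6$) be a longest even cycle among the even cycles of $G$ of length at most $12$, assumed to have length $6$, and let $R=V(G)\setminus V(C)$. Then for every component $K$ of $G[R]$ on at least $3$ vertices there is an index $a$ such that all attachment vertices of $K$ lie in the single antipodal pair $\{c_a,c_{a+3}\}$, and the chord $c_ac_{a+3}$ is an edge of $G$. Moreover no component of $G[R]$ is a star $K_{1,m}$ with $m\ge 3$.
   Context: All graphs are finite and simple. A graph $G$ is uniquely $C_9$-saturated if it contains no cycle of length $9$ and, for every edge $e$ of the complement $\overline{G}$, $G+e$ contains exactly one cycle of length $9$; it is nontrivial if $|V(G)|\ge 9$. $G[R]$ is the subgraph induced on $R$. The attachment vertices of a component $K$ of $G[R]$ are the vertices of $C$ adjacent to at least one vertex of $K$. An antipodal pair is a pair $\{c_a,c_{a+3}\}$ of vertices at distance $3$ along $C$. *)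

theory Defs
  imports Main
begin

text \<open>
  A graph is given by its vertex set \<open>V\<close> and its set \<open>E\<close> of edges, an edge being the
  two-element set of its ends.
\<close>

definition simple_graph :: "'a set \<Rightarrow> 'a set set \<Rightarrow> bool" where
  "simple_graph V E \<longleftrightarrow> finite V \<and> (\<forall>e\<in>E. e \<subseteq> V \<and> card e = 2)"

definition complement_edges :: "'a set \<Rightarrow> 'a set set \<Rightarrow> 'a set set" where
  "complement_edges V E = {e. e \<subseteq> V \<and> card e = 2 \<and> e \<notin> E}"

definition induced_edges :: "'a set set \<Rightarrow> 'a set \<Rightarrow> 'a set set" where
  "induced_edges E S = {e \<in> E. e \<subseteq> S}"

text \<open>The empty graph does not count as connected.\<close>

definition connected_graph :: "'a set \<Rightarrow> 'a set set \<Rightarrow> bool" where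
  "connected_graph V E \<longleftrightarrow>
     V \<noteq> {} \<and> (\<forall>u\<in>V. \<forall>v\<in>V. (u, v) \<in> {(x, y). {x, y} \<in> E}\<^sup>*)"

definition two_connected :: "'a set \<Rightarrow> 'a set set \<Rightarrow> bool" where
  "two_connected V E \<longleftrightarrow>
     3 \<le> card V \<and> connected_graph V E \<and>
     (\<forall>v\<in>V. connected_graph (V - {v}) (induced_edges E (V - {v})))"

text \<open>
  A component is a maximal connected subgraph; it is induced, and is represented by its vertex set.
\<close>

definition is_component :: "'a set \<Rightarrow> 'a set set \<Rightarrow> 'a set \<Rightarrow> bool" where
  "is_component V E K \<longleftrightarrow>
     K \<subseteq> V \<and> connected_graph K (induced_edges E K) \<and>
     (\<forall>L. K \<subseteq> L \<and> L \<subseteq> V \<and> connected_graph L (induced_edges E L) \<longrightarrow> L = K)"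

text \<open>
  A cycle is written as the list \<open>xs\<close> of its vertices in cyclic order. Different lists (rotations,
  reversals) describe the same subgraph, so cycles are counted through their edge sets.
\<close>

definition cycle_edges :: "'a list \<Rightarrow> 'a set set" where
  "cycle_edges xs = {{xs ! i, xs ! (Suc i mod length xs)} | i. i < length xs}"

definition is_cycle :: "'a set set \<Rightarrow> 'a list \<Rightarrow> bool" where
  "is_cycle E xs \<longleftrightarrow> 3 \<le> length xs \<and> distinct xs \<and> cycle_edges xs \<subseteq> E"

definition cycles_of_length :: "nat \<Rightarrow> 'a set set \<Rightarrow> 'a set set set" where
  "cycles_of_length k E = {cycle_edges xs | xs. is_cycle E xs \<and> length xs = k}"

definition uniquely_cycle_saturated :: "nat \<Rightarrow> 'a set \<Rightarrow> 'a set set \<Rightarrow> bool" where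
  "uniquely_cycle_saturated k V E \<longleftrightarrow>
     cycles_of_length k E = {} \<and>
     (\<forall>e \<in> complement_edges V E. \<exists>!D. D \<in> cycles_of_length k (insert e E))"

definition longest_even_cycle_upto :: "nat \<Rightarrow> 'a set set \<Rightarrow> 'a list \<Rightarrow> bool" where
  "longest_even_cycle_upto N E C \<longleftrightarrow>
     is_cycle E C \<and> even (length C) \<and> length C \<le> N \<and>
     (\<forall>D. is_cycle E D \<and> even (length D) \<and> length D \<le> N \<longrightarrow> length D \<le> length C)"

definition attachment_vertices :: "'a set set \<Rightarrow> 'a list \<Rightarrow> 'a set \<Rightarrow> 'a set" where
  "attachment_vertices E C K = {c \<in> set C. \<exists>k\<in>K. {c, k} \<in> E}"

text \<open>The graph \<open>(V, E)\<close> is a \<open>K\<^bsub>1,m\<^esub>\<close> with centre \<open>z\<close> and set of leaves \<open>L\<close>.\<close>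

definition is_star :: "nat \<Rightarrow> 'a set \<Rightarrow> 'a set set \<Rightarrow> bool" where
  "is_star m V E \<longleftrightarrow>
     (\<exists>z L. V = insert z L \<and> z \<notin> L \<and> finite L \<and> card L = m \<and> E = {{z, l} | l. l \<in> L})"

end

theory Submission imports Defs begin

text \<open>
  Saturation says that two distinct vertices are adjacent if no path on nine vertices joins them,
  and are joined by exactly one such path otherwise (\<open>path9_unique\<close>, \<open>path9_exists\<close>). Two
  consequences drive the proof.

  \<^item> There are no nonadjacent twins (\<open>no_twins\<close>): reversing the interior of a path between two
    vertices with the same neighbours gives a second path.
  \<^item> A path that leaves the six-cycle \<open>C\<close> has at most four vertices off \<open>C\<close>
    (\<open>hanging_path_short\<close>): a fifth vertex would be joined to the antipode of the starting point by
    two paths on nine vertices, one along each half of \<open>C\<close>.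

  By the choice of \<open>C\<close> and saturation there are no cycles of lengths 8, 9, 10 and 12. An ear, that
  is a path off \<open>C\<close> that joins two vertices of \<open>C\<close>, therefore has at most three vertices, it has at
  most two unless its ends are antipodal, and only one if they are consecutive (\<open>ear_length\<close>).

  Let \<open>K\<close> be a component with at least three vertices. If it contains an ear on two vertices
  \<open>a, b\<close> and no longer one with the same ends, then a third vertex \<open>x\<close> next to \<open>a\<close> has the same
  two neighbours as \<open>b\<close>, against the absence of twins. Hence two disjoint edges between \<open>K\<close> and \<open>C\<close>
  always give an ear on three vertices, so that their ends on \<open>C\<close> are antipodal
  (\<open>disjoint_attachments\<close>). Such edges exist as the graph is 2-connected, and every further edge
  from \<open>K\<close> to \<open>C\<close> has to fit with both of them; so all attachment vertices lie in one antipodal pair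
  \<open>c, d\<close> (\<open>antipodal_attachments\<close>). If \<open>c\<close> and \<open>d\<close> were not adjacent, the path on nine vertices
  between them would avoid \<open>K\<close>, where all ears are short, and would close up with the ear on three
  vertices to a cycle of length 12 (\<open>attachments_adjacent\<close>).

  Finally let \<open>K\<close> be a star. Each leaf is adjacent to \<open>c\<close> or to \<open>d\<close>, and no two leaves are twins; so
  there are just three leaves, one for each nonempty subset of \<open>{c, d}\<close>. The leaf adjacent to \<open>c\<close>
  only and the leaf adjacent to \<open>d\<close> only are joined by a path on nine vertices. It has to
  contain a stretch between \<open>c\<close> and \<open>d\<close> outside \<open>K\<close>, whose 3, 4 or 5 vertices close up
  with an ear on three vertices of \<open>K\<close> to a cycle of length 8, 9 or 10 (\<open>not_star\<close>).
\<close>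

section \<open>Paths as lists\<close>

fun path_edges :: "'a list \<Rightarrow> 'a set set" where
  "path_edges (x # y # r) = insert {x, y} (path_edges (y # r))"
| "path_edges _ = {}"

definition is_path :: "'a set set \<Rightarrow> 'a list \<Rightarrow> bool" where
  "is_path E xs \<longleftrightarrow> distinct xs \<and> path_edges xs \<subseteq> E"

lemma path_edges_Cons: "path_edges (x # r) = (if r = [] then {} else insert {x, hd r} (path_edges r))"
  by (cases r) auto

lemma path_edges_append:
  "path_edges (xs @ ys) = path_edges xs \<union> path_edges ys \<union>
     (if xs = [] \<or> ys = [] then {} else {{last xs, hd ys}})"
  by (induction xs) (auto simp: path_edges_Cons hd_append)

lemma path_edges_rev: "path_edges (rev xs) = path_edges xs"
  by (induction xs) (auto simp: path_edges_Cons path_edges_append last_rev insert_commute)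

lemma path_edges_subset: "e \<in> path_edges xs \<Longrightarrow> e \<subseteq> set xs"
  by (induction xs) (auto simp: path_edges_Cons split: if_splits)

lemma path_edges_nth: "path_edges xs = {{xs ! i, xs ! Suc i} | i. Suc i < length xs}"
proof (induction xs rule: path_edges.induct)
  case (1 x y r)
  have "{{(x # y # r) ! i, (x # y # r) ! Suc i} | i. Suc i < length (x # y # r)} =
        insert {x, y} {{(y # r) ! i, (y # r) ! Suc i} | i. Suc i < length (y # r)}" (is "?A = ?B")
  proof (intro equalityI subsetI)
    fix e assume "e \<in> ?A"
    then obtain i where "Suc i < length (x # y # r)" "e = {(x # y # r) ! i, (x # y # r) ! Suc i}"
      by blast
    then show "e \<in> ?B" by (cases i) auto
  next
    fix e assume "e \<in> ?B"
    then consider "e = {x, y}" | i where "Suc i < length (y # r)" "e = {(y # r) ! i, (y # r) ! Suc i}"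
      by blast
    then show "e \<in> ?A"
    proof cases
      case 1
      then show ?thesis by (intro CollectI exI[of _ 0]) auto
    next
      case (2 i)
      then show ?thesis by (intro CollectI exI[of _ "Suc i"]) auto
    qed
  qed
  then show ?case using 1 by simp
qed auto

lemma cycle_edges_path:
  assumes "xs \<noteq> []"
  shows "cycle_edges xs = insert {last xs, hd xs} (path_edges xs)"
proof -
  let ?n = "length xs"
  have n: "?n > 0" using assms by simp
  have "cycle_edges xs = (\<lambda>i. {xs ! i, xs ! (Suc i mod ?n)}) ` {..<?n}"
    by (auto simp: cycle_edges_def)
  also have "{..<?n} = insert (?n - 1) {i. Suc i < ?n}"
    using n by auto
  also have "(\<lambda>i. {xs ! i, xs ! (Suc i mod ?n)}) ` \<dots> =
     insert {last xs, hd xs} ((\<lambda>i. {xs ! i, xs ! (Suc i mod ?n)}) ` {i. Suc i < ?n})"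
    using n assms by (simp add: last_conv_nth hd_conv_nth)
  also have "(\<lambda>i. {xs ! i, xs ! (Suc i mod ?n)}) ` {i. Suc i < ?n} = path_edges xs"
    by (auto simp: path_edges_nth)
  finally show ?thesis .
qed

lemma is_cycle_path:
  "is_cycle E xs \<longleftrightarrow> 3 \<le> length xs \<and> is_path E xs \<and> {last xs, hd xs} \<in> E"
  by (cases "xs = []") (auto simp: is_cycle_def is_path_def cycle_edges_path)

lemma cycle_edges_rotate: "cycle_edges (rotate n xs) = cycle_edges xs"
proof (induction n)
  case (Suc n)
  have "cycle_edges (rotate1 ys) = cycle_edges ys" for ys :: "'a list"
  proof (cases ys)
    case (Cons y r)
    then show ?thesis
      by (cases "r = []")
        (simp_all add: cycle_edges_path path_edges_append path_edges_Cons insert_commute)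
  qed simp
  then show ?case using Suc by simp
qed simp

lemma is_path_Nil [simp]: "is_path E []"
  and is_path_Cons:
    "is_path E (x # r) \<longleftrightarrow> x \<notin> set r \<and> is_path E r \<and> (r = [] \<or> {x, hd r} \<in> E)"
  and is_path_append:
    "is_path E (xs @ ys) \<longleftrightarrow> is_path E xs \<and> is_path E ys \<and> set xs \<inter> set ys = {} \<and>
       (xs = [] \<or> ys = [] \<or> {last xs, hd ys} \<in> E)"
  and is_path_rev [simp]: "is_path E (rev xs) \<longleftrightarrow> is_path E xs"
  by (auto simp: is_path_def path_edges_Cons path_edges_append path_edges_rev)

text \<open>
  The edges of a path determine it once the starting point is known: the only edge at the first
  vertex leads to the second.
\<close>
lemma path_edges_inject:
  assumes "distinct xs" "distinct ys" "hd xs = hd ys" "length xs = length ys"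
    and "path_edges xs = path_edges ys"
  shows "xs = ys"
  using assms
proof (induction xs arbitrary: ys rule: path_edges.induct)
  case (1 x y r)
  obtain y' r' where ys: "ys = x # y' # r'"
    using 1 by (cases ys; cases "tl ys") auto
  have E: "insert {x, y} (path_edges (y # r)) = insert {x, y'} (path_edges (y' # r'))"
    using 1(6) ys by simp
  have nx: "x \<notin> e" if "e \<in> path_edges (y # r) \<or> e \<in> path_edges (y' # r')" for e
    using path_edges_subset that 1(2,3) ys by fastforce
  have "{x, y} = {x, y'}" using E nx by blast
  then have "y = y'" by (auto simp: doubleton_eq_iff)
  moreover have "path_edges (y # r) = path_edges (y' # r')"
    using E nx by blast
  ultimately have "y # r = y' # r'"
    using 1 ys by (intro 1(1)) auto
  then show ?case using ys by simp
next
  case ("2_1" ys) then show ?case by simp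
next
  case ("2_2" v ys) then show ?case by (cases ys) auto
qed

lemma closing_edge_not_in_path:
  assumes "distinct xs" "3 \<le> length xs"
  shows "{last xs, hd xs} \<notin> path_edges xs"
proof -
  obtain x y r where xs: "xs = x # y # r" "r \<noteq> []"
    using assms(2) by (cases xs; cases "tl xs"; cases "tl (tl xs)") auto
  have "last r \<noteq> y" using assms(1) xs by auto
  moreover have "x \<notin> e" if "e \<in> path_edges (y # r)" for e
    using path_edges_subset[OF that] assms(1) xs by auto
  ultimately show ?thesis using xs by (auto simp: doubleton_eq_iff)
qed

lemma rtrancl_path:
  assumes "(u, v) \<in> {(x, y). {x, y} \<in> F}\<^sup>*"
  shows "\<exists>p. p \<noteq> [] \<and> is_path F p \<and> hd p = u \<and> last p = v"
  using assms
proof (induction rule: converse_rtrancl_induct)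
  case base
  show ?case by (rule exI[of _ "[v]"]) (simp add: is_path_Cons)
next
  case (step x y)
  then obtain p where p: "p \<noteq> []" "is_path F p" "hd p = y" "last p = v" by blast
  show ?case
  proof (cases "x \<in> set p")
    case True
    then obtain p1 p2 where "p = p1 @ x # p2" by (meson split_list)
    then show ?thesis using p by (intro exI[of _ "x # p2"]) (auto simp: is_path_append)
  next
    case False
    then show ?thesis using p step by (intro exI[of _ "x # p"]) (auto simp: is_path_Cons)
  qed
qed

lemma split_off_ends:
  assumes "length xs = Suc (Suc n)"
  obtains q where "xs = hd xs # q @ [last xs]" "length q = n"
proof -
  obtain u r where r: "xs = u # r" "r \<noteq> []" using assms by (cases xs; cases "tl xs") auto
  then have "xs = hd xs # butlast r @ [last xs]" by simp
  moreover have "length (butlast r) = n" using assms r by simp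
  ultimately show ?thesis using that by blast
qed

lemma is_path_mono: "is_path F p \<Longrightarrow> F \<subseteq> E \<Longrightarrow> is_path E p"
  by (auto simp: is_path_def)

lemma is_path_edges_in:
  assumes "is_path F p" "\<forall>e\<in>F. e \<subseteq> S" "p \<noteq> []" "hd p \<in> S"
  shows "set p \<subseteq> S"
  using assms(1,3,4)
proof (induction p)
  case (Cons x r)
  show ?case
  proof (cases "r = []")
    case False
    then have "{x, hd r} \<in> F" "is_path F r" using Cons by (auto simp: is_path_Cons)
    moreover from this have "hd r \<in> S" using assms(2) by blast
    ultimately show ?thesis using Cons False by simp
  qed (use Cons in simp)
qed simp


section \<open>Paths on nine vertices in a uniquely saturated graph\<close>

locale uniquely_C9_saturated =
  fixes V :: "'a set" and E :: "'a set set"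
  assumes simple: "simple_graph V E"
    and saturated: "uniquely_cycle_saturated 9 V E"
begin

abbreviation adj :: "'a \<Rightarrow> 'a \<Rightarrow> bool" where
  "adj u v \<equiv> {u, v} \<in> E"

lemma adj_commute: "adj u v \<longleftrightarrow> adj v u"
  by (simp add: insert_commute)

lemma adj_vertices: "adj u v \<Longrightarrow> u \<in> V \<and> v \<in> V \<and> u \<noteq> v"
  using simple by (auto simp: simple_graph_def)

lemma no_C9: "is_cycle E D \<Longrightarrow> length D \<noteq> 9"
  using saturated by (auto simp: uniquely_cycle_saturated_def cycles_of_length_def)

lemma path9_nonadjacent:
  assumes "is_path E xs" "length xs = 9"
  shows "\<not> adj (last xs) (hd xs)"
  using no_C9[of xs] assms by (auto simp: is_cycle_path)

lemma path_vertices: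
  assumes "is_path E p" "2 \<le> length p"
  shows "set p \<subseteq> V"
proof -
  obtain x y r where p: "p = x # y # r" using assms(2) by (cases p; cases "tl p") auto
  then have "adj x y" using assms by (simp add: is_path_Cons)
  then show ?thesis
    using is_path_edges_in[OF assms(1), of V] simple p adj_vertices[of x y]
    by (auto simp: simple_graph_def)
qed

text \<open>
  Adding the edge between the ends of the two paths closes both to cycles of length 9, which
  saturation identifies. Removing that edge again identifies the paths.
\<close>
lemma path9_unique:
  assumes xs: "is_path E xs" "length xs = 9" and ys: "is_path E ys" "length ys = 9"
    and ends: "hd xs = hd ys" "last xs = last ys"
  shows "xs = ys"
proof -
  let ?e = "{last xs, hd xs}"
  have e: "?e \<in> complement_edges V E"
  proof -
    have ne: "xs \<noteq> []" using xs(2) by auto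
    have "last xs \<noteq> hd xs"
      using xs by (cases xs) (auto simp: is_path_def)
    moreover have "last xs \<in> V" "hd xs \<in> V"
      using path_vertices[of xs] xs ne by auto
    ultimately show ?thesis
      using path9_nonadjacent[OF xs] by (auto simp: complement_edges_def)
  qed
  have "cycle_edges zs \<in> cycles_of_length 9 (insert ?e E)"
    if "is_path E zs" "length zs = 9" "hd zs = hd xs" "last zs = last xs" for zs
    using that unfolding cycles_of_length_def
    by (intro CollectI exI[of _ zs]) (auto simp: is_cycle_path intro: is_path_mono)
  then have "cycle_edges xs = cycle_edges ys"
    using saturated e xs ys ends unfolding uniquely_cycle_saturated_def by metis
  have closed: "cycle_edges zs = insert ?e (path_edges zs) \<and> ?e \<notin> path_edges zs"
    if "is_path E zs" "length zs = 9" "hd zs = hd xs" "last zs = last xs" for zs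
  proof -
    have "zs \<noteq> []" "distinct zs" "3 \<le> length zs"
      using that(1,2) by (auto simp: is_path_def)
    then show ?thesis
      using cycle_edges_path[of zs] closing_edge_not_in_path[of zs] that(3,4) by simp
  qed
  have "path_edges xs = path_edges ys"
    using \<open>cycle_edges xs = cycle_edges ys\<close> closed[OF xs refl refl] closed[OF ys ends[symmetric]]
    by (metis insert_ident)
  moreover have "distinct xs" "distinct ys" using xs ys unfolding is_path_def by blast+
  ultimately show ?thesis
    using path_edges_inject[of xs ys] xs(2) ys(2) ends(1) by simp
qed

text \<open>
  The cycle that arises when \<open>uv\<close> is added must use \<open>uv\<close>; cut it there.
\<close>
lemma path9_exists:
  assumes "u \<in> V" "v \<in> V" "u \<noteq> v" "\<not> adj u v"
  obtains xs where "is_path E xs" "length xs = 9" "hd xs = u" "last xs = v"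
proof -
  let ?e = "{u, v}"
  have "?e \<in> complement_edges V E"
    using assms by (auto simp: complement_edges_def)
  then have "\<exists>D. D \<in> cycles_of_length 9 (insert ?e E)"
    using saturated unfolding uniquely_cycle_saturated_def by blast
  then obtain xs where xs: "is_cycle (insert ?e E) xs" "length xs = 9"
    unfolding cycles_of_length_def by blast
  have "\<not> is_cycle E xs" using no_C9 xs(2) by blast
  then have "?e \<in> cycle_edges xs" using xs(1) unfolding is_cycle_def by blast
  then obtain i where i: "i < 9" "?e = {xs ! i, xs ! (Suc i mod 9)}"
    using xs(2) by (auto simp: cycle_edges_def)
  define ys where "ys = rotate (Suc i) xs"
  have ys: "distinct ys" "length ys = 9" "ys \<noteq> []"
    using xs by (auto simp: ys_def is_cycle_def)
  have "hd ys = xs ! (Suc i mod 9)"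
    unfolding ys_def using xs(2) by (subst hd_rotate_conv_nth) auto
  moreover have "last ys = xs ! i"
  proof -
    have "last ys = ys ! 8" using ys by (simp add: last_conv_nth)
    also have "\<dots> = xs ! ((Suc i + 8) mod 9)"
      unfolding ys_def using xs(2) by (subst nth_rotate) auto
    also have "(Suc i + 8) mod 9 = i" using i(1) by simp
    finally show ?thesis .
  qed
  ultimately have e: "?e = {last ys, hd ys}" using i(2) by simp
  have "insert ?e (path_edges ys) \<subseteq> insert ?e E"
    using xs(1) cycle_edges_path[OF ys(3)] e cycle_edges_rotate[of "Suc i" xs]
    unfolding is_cycle_def ys_def by simp
  moreover have "?e \<notin> path_edges ys"
    unfolding e using closing_edge_not_in_path[of ys] ys by simp
  ultimately have p: "is_path E ys" using ys by (auto simp: is_path_def)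
  consider "hd ys = u" "last ys = v" | "hd ys = v" "last ys = u"
    using e by (auto simp: doubleton_eq_iff)
  then show ?thesis
  proof cases
    case 1 then show ?thesis using that p ys by blast
  next
    case 2 then show ?thesis using that[of "rev ys"] p ys by (simp add: hd_rev last_rev)
  qed
qed

text \<open>
  The interior of a path from \<open>u\<close> to \<open>v\<close> on nine vertices can be traversed backwards as well, since
  its first and last vertex are adjacent to both \<open>u\<close> and \<open>v\<close>.
\<close>
lemma no_twins:
  assumes "u \<in> V" "v \<in> V" "u \<noteq> v" "\<not> adj u v" and twins: "\<And>w. adj u w \<longleftrightarrow> adj v w"
  shows False
proof -
  obtain xs where xs: "is_path E xs" "length xs = 9" "hd xs = u" "last xs = v"
    using path9_exists assms(1-4) by blast
  obtain q where "xs = hd xs # q @ [last xs]" "length q = 7"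
    using split_off_ends[of xs 7] xs(2) by auto
  then have q: "xs = u # q @ [v]" "length q = 7" "q \<noteq> []"
    using xs by auto
  have p: "is_path E q" "u \<notin> set q" "v \<notin> set q" "adj u (hd q)" "adj (last q) v"
    using xs(1) q by (auto simp: is_path_Cons is_path_append)
  have "adj u (last q)" "adj (hd q) v"
    using twins p adj_commute by metis+
  then have "is_path E (u # rev q @ [v])"
    using p q assms(3) by (auto simp: is_path_Cons is_path_append hd_rev last_rev)
  then have "u # rev q @ [v] = xs"
    using xs q by (intro path9_unique) auto
  then have "rev q = q" using q by simp
  then have "hd q = last q" using hd_rev[of q] by simp
  then show False
    using p(1) q(2) by (cases q) (auto simp: is_path_def split: if_splits)
qed

end


section \<open>A six-cycle and the paths that leave it\<close>

definition consecutive_on :: "'a list \<Rightarrow> 'a \<Rightarrow> 'a \<Rightarrow> bool" where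
  "consecutive_on C u v \<longleftrightarrow> {u, v} \<in> cycle_edges C"

definition antipodal_on :: "'a list \<Rightarrow> 'a \<Rightarrow> 'a \<Rightarrow> bool" where
  "antipodal_on C u v \<longleftrightarrow> (\<exists>a<6. {u, v} = {C ! a, C ! ((a + 3) mod 6)})"

lemma antipodal_on_list:
  "antipodal_on [d0, d1, d2, d3, d4, d5] u v \<longleftrightarrow> {u, v} \<in> {{d0, d3}, {d1, d4}, {d2, d5}}"
proof -
  have ex6: "(\<exists>a<6. P a) \<longleftrightarrow> P 0 \<or> P 1 \<or> P 2 \<or> P 3 \<or> P 4 \<or> P (5 :: nat)" for P
    by (auto simp: eval_nat_numeral less_Suc_eq)
  show ?thesis unfolding antipodal_on_def ex6 by (auto simp: doubleton_eq_iff)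
qed

lemma antipodal_on_rotate:
  assumes "length C = 6"
  shows "antipodal_on (rotate n C) u v \<longleftrightarrow> antipodal_on C u v"
proof (induction n)
  case (Suc n)
  have "antipodal_on (rotate1 D) u v \<longleftrightarrow> antipodal_on D u v" if D: "length D = 6" for D :: "'a list"
  proof -
    obtain d0 d1 d2 d3 d4 d5 where D': "D = [d0, d1, d2, d3, d4, d5]"
      using D by (auto simp: length_Suc_conv eval_nat_numeral)
    show ?thesis unfolding D' by (auto simp: antipodal_on_list insert_commute)
  qed
  then show ?case using Suc assms by simp
qed simp

lemma consecutive_on_list:
  "consecutive_on [d0, d1, d2, d3, d4, d5] u v \<longleftrightarrow>
     {u, v} \<in> {{d0, d1}, {d1, d2}, {d2, d3}, {d3, d4}, {d4, d5}, {d5, d0}}"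
  by (auto simp: consecutive_on_def cycle_edges_path insert_commute)

text \<open>
  By rotational symmetry any vertex of the six-cycle may be taken as the first one.
\<close>
lemma six_cycle_from:
  assumes "is_cycle E C" "length C = 6" "u \<in> set C"
  obtains d1 d2 d3 d4 d5 where "is_cycle E [u, d1, d2, d3, d4, d5]"
    "set C = {u, d1, d2, d3, d4, d5}"
    "\<And>x y. antipodal_on C x y \<longleftrightarrow> {x, y} \<in> {{u, d3}, {d1, d4}, {d2, d5}}"
    "\<And>x y. consecutive_on C x y \<longleftrightarrow>
       {x, y} \<in> {{u, d1}, {d1, d2}, {d2, d3}, {d3, d4}, {d4, d5}, {d5, u}}"
proof -
  obtain i where i: "i < 6" "u = C ! i" using assms by (auto simp: in_set_conv_nth)
  define D where "D = rotate i C"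
  have l: "length D = 6" using assms by (simp add: D_def)
  obtain d0 d1 d2 d3 d4 d5 where D': "D = [d0, d1, d2, d3, d4, d5]"
    using l by (auto simp: length_Suc_conv eval_nat_numeral)
  have "hd D = u" unfolding D_def using assms i by (subst hd_rotate_conv_nth) auto
  then have D: "D = [u, d1, d2, d3, d4, d5]" using D' by simp
  have "is_cycle E D" using assms by (simp add: is_cycle_def D_def cycle_edges_rotate)
  moreover have "set C = set D" by (simp add: D_def)
  moreover have "antipodal_on C x y \<longleftrightarrow> antipodal_on D x y" for x y
    using antipodal_on_rotate assms unfolding D_def by metis
  moreover have "consecutive_on C x y \<longleftrightarrow> consecutive_on D x y" for x y
    unfolding consecutive_on_def D_def by (simp add: cycle_edges_rotate)
  ultimately show ?thesis
    using that unfolding D antipodal_on_list consecutive_on_list by simp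
qed

locale saturated_with_six_cycle = uniquely_C9_saturated +
  fixes C :: "'a list"
  assumes two_conn: "two_connected V E"
    and longest: "longest_even_cycle_upto 12 E C"
    and length_C: "length C = 6"
begin

lemma cycle_C: "is_cycle E C"
  using longest by (simp add: longest_even_cycle_upto_def)

lemma set_C_subset: "set C \<subseteq> V"
  using path_vertices[of C] cycle_C length_C by (simp add: is_cycle_path)

lemma forbidden_cycle_lengths: "is_cycle E D \<Longrightarrow> length D \<notin> {8, 9, 10, 12}"
  using longest no_C9 length_C unfolding longest_even_cycle_upto_def by fastforce

abbreviation consecutive :: "'a \<Rightarrow> 'a \<Rightarrow> bool" where "consecutive \<equiv> consecutive_on C"
abbreviation antipodal :: "'a \<Rightarrow> 'a \<Rightarrow> bool" where "antipodal \<equiv> antipodal_on C"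

lemma antipodal_commute: "antipodal u v \<longleftrightarrow> antipodal v u"
  by (simp add: antipodal_on_def insert_commute)

text \<open>
  The lengths count vertices. The longer of the two arcs between \<open>u\<close> and \<open>v\<close> is taken; closing it
  with an ear gives the cycles whose lengths are forbidden.
\<close>
lemma arc:
  assumes "u \<in> set C" "v \<in> set C" "u \<noteq> v"
  obtains A where "is_path E A" "set A \<subseteq> set C" "A \<noteq> []" "hd A = v" "last A = u"
    "length A = (if consecutive u v then 6 else if antipodal u v then 4 else 5)"
proof -
  obtain d1 d2 d3 d4 d5 where D: "is_cycle E [u, d1, d2, d3, d4, d5]"
    "set C = {u, d1, d2, d3, d4, d5}"
    "\<And>x y. antipodal x y \<longleftrightarrow> {x, y} \<in> {{u, d3}, {d1, d4}, {d2, d5}}"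
    "\<And>x y. consecutive x y \<longleftrightarrow>
       {x, y} \<in> {{u, d1}, {d1, d2}, {d2, d3}, {d3, d4}, {d4, d5}, {d5, u}}"
    using six_cycle_from[OF cycle_C length_C assms(1)] by metis
  consider "v = d1" | "v = d2" | "v = d3" | "v = d4" | "v = d5"
    using assms D(2) by auto
  then show ?thesis
  proof cases
    case 1
    with D show ?thesis
      by (intro that[of "[d1, d2, d3, d4, d5, u]"])
        (auto simp: is_cycle_path is_path_Cons doubleton_eq_iff insert_commute)
  next
    case 2
    with D show ?thesis
      by (intro that[of "[d2, d3, d4, d5, u]"])
        (auto simp: is_cycle_path is_path_Cons doubleton_eq_iff insert_commute)
  next
    case 3
    with D show ?thesis
      by (intro that[of "[d3, d4, d5, u]"])
        (auto simp: is_cycle_path is_path_Cons doubleton_eq_iff insert_commute)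
  next
    case 4
    with D show ?thesis
      by (intro that[of "[d4, d3, d2, d1, u]"])
        (auto simp: is_cycle_path is_path_Cons doubleton_eq_iff insert_commute)
  next
    case 5
    with D show ?thesis
      by (intro that[of "[d5, d4, d3, d2, d1, u]"])
        (auto simp: is_cycle_path is_path_Cons doubleton_eq_iff insert_commute)
  qed
qed

text \<open>
  A vertex \<open>u\<close> that is neither equal nor next to \<open>v\<close>, nor antipodal to it, is at distance 2 from \<open>v\<close>,
  hence next to the antipode of \<open>v\<close>.
\<close>
lemma consecutive_to_antipode:
  assumes "u \<in> set C" "v \<in> set C" "w \<in> set C" "u \<noteq> v" "u \<noteq> w"
    and "\<not> consecutive u v" "antipodal v w"
  shows "consecutive u w"
proof -
  obtain d1 d2 d3 d4 d5 where D: "is_cycle E [u, d1, d2, d3, d4, d5]"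
    "set C = {u, d1, d2, d3, d4, d5}"
    "\<And>x y. antipodal x y \<longleftrightarrow> {x, y} \<in> {{u, d3}, {d1, d4}, {d2, d5}}"
    "\<And>x y. consecutive x y \<longleftrightarrow>
       {x, y} \<in> {{u, d1}, {d1, d2}, {d2, d3}, {d3, d4}, {d4, d5}, {d5, u}}"
    using six_cycle_from[OF cycle_C length_C assms(1)] by metis
  show ?thesis using assms D(1,2) unfolding D(3,4)
    by (auto simp: is_cycle_path is_path_Cons doubleton_eq_iff)
qed

text \<open>
  The two halves of the six-cycle between \<open>c\<close> and its antipode have four vertices each. Prolonged by
  the same five vertices off the cycle they would be two paths on nine vertices with equal ends.
\<close>
lemma hanging_path_short:
  assumes c: "c \<in> set C" and p: "is_path E p" "p \<noteq> []" "set p \<inter> set C = {}" "adj c (hd p)"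
  shows "length p \<le> 4"
proof (rule ccontr)
  assume long: "\<not> length p \<le> 4"
  define q where "q = take 5 p"
  have pq: "p = q @ drop 5 p" unfolding q_def by simp
  then have q: "is_path E q" using p(1) is_path_append[of E q "drop 5 p"] by simp
  have qC: "set q \<inter> set C = {}" using p(3) by (auto simp: q_def dest: in_set_takeD)
  have q': "length q = 5" "q \<noteq> []" "hd q = hd p" using long p by (auto simp: q_def)
  obtain d1 d2 d3 d4 d5 where D: "is_cycle E [c, d1, d2, d3, d4, d5]"
    "set C = {c, d1, d2, d3, d4, d5}"
    using six_cycle_from[OF cycle_C length_C c] by metis
  have d: "distinct [c, d1, d2, d3, d4, d5]" "adj c d1" "adj d1 d2" "adj d2 d3" "adj d3 d4"
    "adj d4 d5" "adj d5 c"
    using D(1) by (auto simp: is_cycle_path is_path_Cons)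
  have "is_path E [d3, d2, d1, c]" "is_path E [d3, d4, d5, c]"
    using d by (auto simp: is_path_Cons insert_commute)
  moreover have "set [d3, d2, d1, c] \<inter> set q = {}" "set [d3, d4, d5, c] \<inter> set q = {}"
    using qC D(2) by auto
  ultimately have "is_path E ([d3, d2, d1, c] @ q)" "is_path E ([d3, d4, d5, c] @ q)"
    using q q' p(4) unfolding is_path_append by simp_all
  then have "[d3, d2, d1, c] @ q = [d3, d4, d5, c] @ q"
    using q' by (intro path9_unique) simp_all
  then show False using d by simp
qed

text \<open>The list \<open>p\<close> consists of the inner vertices; the ends \<open>c\<close> and \<open>d\<close> are kept apart from it.\<close>
definition ear :: "'a \<Rightarrow> 'a list \<Rightarrow> 'a \<Rightarrow> bool" where
  "ear c p d \<longleftrightarrow> c \<in> set C \<and> d \<in> set C \<and> c \<noteq> d \<and> p \<noteq> [] \<and> is_path E p \<and> set p \<inter> set C = {} \<and>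
     adj c (hd p) \<and> adj (last p) d"

lemma ear_rev: "ear c p d \<Longrightarrow> ear d (rev p) c"
  by (auto simp: ear_def hd_rev last_rev insert_commute)

text \<open>
  Closing an ear on \<open>t\<close> vertices with the longer arc between its ends gives a cycle of length
  \<open>t + 6\<close>, \<open>t + 5\<close> or \<open>t + 4\<close>, according to whether the ends are at distance 1, 2 or 3, and
  \<open>t\<close> is at most 4.
\<close>
lemma ear_length:
  assumes "ear c p d"
  shows "length p \<le> 3" and "3 \<le> length p \<Longrightarrow> antipodal c d"
    and "2 \<le> length p \<Longrightarrow> \<not> consecutive c d"
proof -
  have e: "c \<in> set C" "d \<in> set C" "c \<noteq> d" "p \<noteq> []" "is_path E p" "set p \<inter> set C = {}"
    "adj c (hd p)" "adj (last p) d"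
    using assms by (auto simp: ear_def)
  obtain A where A: "is_path E A" "set A \<subseteq> set C" "A \<noteq> []" "hd A = d" "last A = c"
    "length A = (if consecutive c d then 6 else if antipodal c d then 4 else 5)"
    using arc[of c d] e by metis
  have "is_path E (p @ A)" using e A unfolding is_path_append by auto
  moreover have "3 \<le> length (p @ A)" using A(6) by (simp split: if_splits)
  ultimately have "is_cycle E (p @ A)" using e A by (simp add: is_cycle_path)
  then have "length p + length A \<notin> {8, 9, 10, 12}"
    using forbidden_cycle_lengths by fastforce
  moreover have "length p \<le> 4" using hanging_path_short e by blast
  moreover have "length p \<ge> 1" using e by (simp add: Suc_le_eq)
  ultimately show "length p \<le> 3" and "3 \<le> length p \<Longrightarrow> antipodal c d"
    and "2 \<le> length p \<Longrightarrow> \<not> consecutive c d"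
    using A(6) by (auto split: if_splits)
qed

text \<open>
  The path \<open>p'\<close> may pass through \<open>C\<close>, as long as it avoids the ends of the ear.
\<close>
lemma two_ears_length:
  assumes "ear c p d" "p' \<noteq> []" "is_path E p'" "adj c (hd p')" "adj (last p') d"
    "set p' \<inter> set p = {}" "c \<notin> set p'" "d \<notin> set p'"
  shows "length p + length p' + 2 \<notin> {8, 9, 10, 12}"
proof -
  have e: "c \<in> set C" "d \<in> set C" "c \<noteq> d" "p \<noteq> []" "is_path E p" "set p \<inter> set C = {}"
    "adj c (hd p)" "adj (last p) d"
    using assms(1) by (auto simp: ear_def)
  have "is_path E (d # rev p' @ [c])"
    using assms(2-) e adj_commute
    by (auto simp: is_path_append is_path_Cons hd_rev last_rev hd_append)
  moreover have "set p \<inter> set (d # rev p' @ [c]) = {}" using assms(6) e by auto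
  ultimately have "is_path E (p @ d # rev p' @ [c])"
    using e unfolding is_path_append by simp
  moreover have "3 \<le> length (p @ d # rev p' @ [c])" using e(4) by (cases p) auto
  ultimately have "is_cycle E (p @ d # rev p' @ [c])"
    using e by (simp add: is_cycle_path)
  then show ?thesis using forbidden_cycle_lengths by fastforce
qed

end


section \<open>Large components off the six-cycle\<close>

locale large_component = saturated_with_six_cycle +
  fixes K :: "'a set"
  assumes component: "is_component (V - set C) (induced_edges E (V - set C)) K"
    and card_K: "3 \<le> card K"
begin

lemma K_subset: "K \<subseteq> V - set C"
  using component by (simp add: is_component_def)

lemma induced_edges_K:
  "L \<subseteq> V - set C \<Longrightarrow> induced_edges (induced_edges E (V - set C)) L = induced_edges E L"
  by (auto simp: induced_edges_def)

lemma path_in_K: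
  assumes "x \<in> K" "y \<in> K"
  obtains p where "is_path E p" "p \<noteq> []" "hd p = x" "last p = y" "set p \<subseteq> K"
proof -
  have "connected_graph K (induced_edges E K)"
    using component K_subset by (simp add: is_component_def induced_edges_K)
  then have "(x, y) \<in> {(x, y). {x, y} \<in> induced_edges E K}\<^sup>*"
    using assms by (simp add: connected_graph_def)
  from rtrancl_path[OF this] obtain p
    where p: "p \<noteq> []" "is_path (induced_edges E K) p" "hd p = x" "last p = y" by blast
  have "is_path E p" using p(2) by (rule is_path_mono) (auto simp: induced_edges_def)
  moreover have "set p \<subseteq> K"
    using is_path_edges_in[OF p(2), of K] p assms by (auto simp: induced_edges_def)
  ultimately show ?thesis using that p by blast
qed

text \<open>Otherwise \<open>K\<close> together with \<open>y\<close> would be a larger connected subgraph.\<close>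
lemma K_closed:
  assumes x: "x \<in> K" and xy: "adj x y" and y: "y \<notin> set C"
  shows "y \<in> K"
proof -
  let ?L = "insert y K"
  let ?r = "{(u, v). {u, v} \<in> induced_edges E ?L}"
  have conn: "connected_graph K (induced_edges E K)"
    using component K_subset by (simp add: is_component_def induced_edges_K)
  have yV: "y \<in> V" using adj_vertices xy by blast
  have K: "(u, v) \<in> ?r\<^sup>*" if "u \<in> K" "v \<in> K" for u v
  proof -
    have "(u, v) \<in> {(u, v). {u, v} \<in> induced_edges E K}\<^sup>*"
      using conn that by (simp add: connected_graph_def)
    then show ?thesis
      by (rule rtrancl_mono[THEN subsetD, rotated]) (auto simp: induced_edges_def)
  qed
  have "(x, y) \<in> ?r" "(y, x) \<in> ?r"
    using x xy by (auto simp: induced_edges_def insert_commute)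
  then have "(u, v) \<in> ?r\<^sup>*" if "u \<in> ?L" "v \<in> ?L" for u v
    using K[of u x] K[of x v] K[of u v] x that
    by (auto intro: rtrancl_into_rtrancl converse_rtrancl_into_rtrancl)
  then have "connected_graph ?L (induced_edges E ?L)"
    by (simp add: connected_graph_def)
  moreover have "?L \<subseteq> V - set C" using K_subset y yV by blast
  ultimately have "?L = K"
    using component unfolding is_component_def by (metis induced_edges_K subset_insertI)
  then show ?thesis by blast
qed

text \<open>
  This is how 2-connectedness is used: the graph without \<open>w\<close> is connected, so a walk from \<open>x\<close> to \<open>C\<close>
  survives the removal of \<open>w\<close>, and it stays in \<open>K\<close> until it first meets \<open>C\<close>.
\<close>
lemma escape:
  assumes x: "x \<in> K" "x \<noteq> w" and w: "w \<in> V"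
  obtains p d where "is_path E p" "p \<noteq> []" "hd p = x" "set p \<subseteq> K - {w}"
    "d \<in> set C" "d \<noteq> w" "adj (last p) d"
proof -
  have "\<not> set C \<subseteq> {w}"
  proof
    assume "set C \<subseteq> {w}"
    then have "card (set C) \<le> 1" using card_mono[of "{w}"] by simp
    then show False using cycle_C length_C by (simp add: is_cycle_def distinct_card)
  qed
  then obtain s where s: "s \<in> set C" "s \<noteq> w" by blast
  have "connected_graph (V - {w}) (induced_edges E (V - {w}))"
    using two_conn w by (simp add: two_connected_def)
  then have "(x, s) \<in> {(u, v). {u, v} \<in> induced_edges E (V - {w})}\<^sup>*"
    using x s set_C_subset K_subset by (auto simp: connected_graph_def)
  then have "x \<in> K \<Longrightarrow> \<exists>p d. is_path E p \<and> p \<noteq> [] \<and> hd p = x \<and> set p \<subseteq> K - {w} \<and>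
    d \<in> set C \<and> d \<noteq> w \<and> adj (last p) d"
  proof (induction rule: converse_rtrancl_induct)
    case base
    then show ?case using s K_subset by blast
  next
    case (step u v)
    have uv: "adj u v" "u \<noteq> w" "v \<noteq> w" using step(1) by (auto simp: induced_edges_def)
    show ?case
    proof (cases "v \<in> set C")
      case True
      then show ?thesis using uv step
        by (intro exI[of _ "[u]"] exI[of _ v]) (auto simp: is_path_Cons)
    next
      case False
      then have "v \<in> K" using K_closed step uv by blast
      with step obtain p d where p: "is_path E p" "p \<noteq> []" "hd p = v" "set p \<subseteq> K - {w}"
        "d \<in> set C" "d \<noteq> w" "adj (last p) d" by blast
      show ?thesis
      proof (cases "u \<in> set p")
        case True
        then obtain p1 p2 where "p = p1 @ u # p2" by (meson split_list)
        then show ?thesis using p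
          by (intro exI[of _ "u # p2"] exI[of _ d]) (auto simp: is_path_append)
      next
        case False
        then show ?thesis using p uv step
          by (intro exI[of _ "u # p"] exI[of _ d]) (auto simp: is_path_Cons)
      qed
    qed
  qed
  then show ?thesis using that x by blast
qed

definition inner_ear :: "'a \<Rightarrow> 'a list \<Rightarrow> 'a \<Rightarrow> bool" where
  "inner_ear c p d \<longleftrightarrow> ear c p d \<and> set p \<subseteq> K"

lemma inner_ear_rev: "inner_ear c p d \<Longrightarrow> inner_ear d (rev p) c"
  by (simp add: inner_ear_def ear_rev)

lemma inner_earI:
  assumes "is_path E p" "p \<noteq> []" "set p \<subseteq> K" "c \<in> set C" "d \<in> set C" "c \<noteq> d"
    "adj c (hd p)" "adj (last p) d"
  shows "inner_ear c p d"
  using assms K_subset by (auto simp: inner_ear_def ear_def)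

lemma inner_ear_length:
  assumes "inner_ear c p d"
  shows "length p \<le> 3" and "3 \<le> length p \<Longrightarrow> antipodal c d"
    and "2 \<le> length p \<Longrightarrow> \<not> consecutive c d"
  using assms ear_length[of c p d] unfolding inner_ear_def by blast+

text \<open>
  From \<open>x\<close> one can leave \<open>K\<close> without passing through \<open>a\<close>. A path that runs through \<open>b\<close>, or one
  that ends at \<open>c\<close>, creates an ear from \<open>c\<close> to \<open>d\<close> on at least three vertices. If the path ends in
  another vertex \<open>e\<close> different from \<open>d\<close>, then \<open>d\<close> and \<open>e\<close> are the ends of an ear on three or more
  vertices and so antipodal, which puts \<open>e\<close> next to \<open>c\<close>; but \<open>c\<close> and \<open>e\<close> are the ends of an ear on
  at least two vertices. So the path ends in \<open>d\<close>, and the bound leaves room for \<open>x\<close> only.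
\<close>
lemma second_neighbour_attaches:
  assumes ear: "inner_ear c [a, b] d"
    and short: "\<And>p. inner_ear c p d \<Longrightarrow> length p \<le> 2"
    and x: "x \<in> K" "adj a x" "x \<noteq> b"
  shows "adj x d"
proof -
  have ab: "a \<in> K" "b \<in> K" "a \<noteq> b" "adj a b" "adj c a" "adj b d" "c \<in> set C" "d \<in> set C" "c \<noteq> d"
    using ear by (auto simp: inner_ear_def ear_def is_path_Cons)
  have xa: "x \<noteq> a" using x adj_vertices by blast
  obtain p e where p: "is_path E p" "p \<noteq> []" "hd p = x" "set p \<subseteq> K - {a}"
    "e \<in> set C" "e \<noteq> a" "adj (last p) e"
    using escape[OF x(1) xa] ab K_subset by blast
  have "b \<notin> set p"
  proof
    assume "b \<in> set p"
    then obtain p1 p2 where p': "p = p1 @ b # p2" by (meson split_list)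
    then have "p1 \<noteq> []" "hd p1 = x" using p x by (auto simp: hd_append split: if_splits)
    then have "inner_ear c (a # p1 @ [b]) d"
      using p p' ab x by (intro inner_earI) (auto simp: is_path_append is_path_Cons)
    then show False using short \<open>p1 \<noteq> []\<close> by fastforce
  qed
  then have path: "is_path E (b # a # p)"
    using p ab x by (auto simp: is_path_Cons insert_commute)
  have "e = d"
  proof (rule ccontr)
    assume "e \<noteq> d"
    then have 1: "inner_ear d (b # a # p) e"
      using p ab path by (intro inner_earI) (auto simp: insert_commute)
    have "length p \<ge> 1" using p by (simp add: Suc_le_eq)
    then have opp: "antipodal d e" using inner_ear_length(2)[OF 1] by simp
    have "e \<noteq> c"
      using short[OF inner_ear_rev] 1 \<open>length p \<ge> 1\<close> by fastforce
    then have "inner_ear c (a # p) e"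
      using p ab path by (intro inner_earI) (auto simp: is_path_Cons)
    then have "\<not> consecutive c e" using inner_ear_length(3) \<open>length p \<ge> 1\<close> by fastforce
    moreover have "\<not> consecutive c d" using inner_ear_length(3)[OF ear] by simp
    ultimately show False
      using consecutive_to_antipode[of c d e] opp ab p \<open>e \<noteq> c\<close> by blast
  qed
  then have "inner_ear c (a # p) d"
    using p ab path by (intro inner_earI) (auto simp: is_path_Cons)
  then have "length p \<le> 1" using short by fastforce
  then have "p = [x]" using p by (cases p) auto
  then show ?thesis using p \<open>e = d\<close> by simp
qed

text \<open>
  A further neighbour \<open>w\<close> of \<open>b\<close> in \<open>K\<close> would be adjacent to \<open>c\<close>, by the previous lemma for the
  reversed ear, and together with \<open>x\<close>, which is adjacent to \<open>d\<close>, give a longer ear; so would the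
  edge \<open>bx\<close>. A further neighbour \<open>w\<close> on \<open>C\<close> is antipodal to \<open>d\<close> because of the ear from \<open>d\<close>
  along \<open>x, a, b\<close>. It is not \<open>c\<close>, since that ear would be too long, so it lies next to \<open>c\<close>,
  against the ear from \<open>c\<close> along \<open>a, b\<close>.
\<close>
lemma short_ear_neighbours:
  assumes ear: "inner_ear c [a, b] d"
    and short: "\<And>p. inner_ear c p d \<Longrightarrow> length p \<le> 2"
    and x: "x \<in> K" "adj a x" "x \<noteq> b"
  shows "adj b w \<longleftrightarrow> w = a \<or> w = d"
proof
  have ab: "a \<in> K" "b \<in> K" "a \<noteq> b" "adj a b" "adj c a" "adj b d" "c \<in> set C" "d \<in> set C" "c \<noteq> d"
    using ear by (auto simp: inner_ear_def ear_def is_path_Cons)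
  then show "w = a \<or> w = d \<Longrightarrow> adj b w" using adj_commute by blast
  have xd: "adj x d" using second_neighbour_attaches[OF assms] .
  have xa: "x \<noteq> a" using x adj_vertices by blast
  assume bw: "adj b w"
  show "w = a \<or> w = d"
  proof (rule ccontr)
    assume wn: "\<not> (w = a \<or> w = d)"
    show False
    proof (cases "w \<in> set C")
      case False
      then have w: "w \<in> K" using K_closed ab bw by blast
      have wb: "w \<noteq> b" using bw adj_vertices by blast
      have "inner_ear d [b, a] c" using inner_ear_rev[OF ear] by simp
      moreover have "length p \<le> 2" if "inner_ear d p c" for p
        using short[OF inner_ear_rev[OF that]] by simp
      ultimately have wc: "adj w c"
        using second_neighbour_attaches[of d b a c w] w bw wn by blast
      show False
      proof (cases "w = x")
        case True
        have "inner_ear c [a, x, b] d"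
          using ab x xa bw True by (intro inner_earI) (auto simp: is_path_Cons insert_commute)
        then show False using short by fastforce
      next
        case False
        have "inner_ear c [w, b, a, x] d"
          using ab x xa bw wb w wn wc xd False
          by (intro inner_earI) (auto simp: is_path_Cons insert_commute)
        then show False using short by fastforce
      qed
    next
      case True
      have 1: "inner_ear w [b, a, x] d"
        using ab x xa xd bw wn True by (intro inner_earI) (auto simp: is_path_Cons insert_commute)
      then have opp: "antipodal d w" using inner_ear_length(2)[OF 1] antipodal_commute by simp
      have "w \<noteq> c" using 1 short by fastforce
      then have "inner_ear c [a, b] w"
        using ab bw True by (intro inner_earI) (auto simp: is_path_Cons)
      then have "\<not> consecutive c w" using inner_ear_length(3) by fastforce
      moreover have "\<not> consecutive c d" using inner_ear_length(3)[OF ear] by simp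
      ultimately show False
        using consecutive_to_antipode[of c d w] opp ab True \<open>w \<noteq> c\<close> by blast
    qed
  qed
qed

text \<open>
  The vertices \<open>b\<close> and \<open>x\<close> play symmetric roles, so both have exactly the neighbours \<open>a\<close> and \<open>d\<close>.
\<close>
lemma no_short_ear_with_branch:
  assumes ear: "inner_ear c [a, b] d"
    and short: "\<And>p. inner_ear c p d \<Longrightarrow> length p \<le> 2"
    and x: "x \<in> K" "adj a x" "x \<noteq> b"
  shows False
proof -
  have ab: "a \<in> K" "b \<in> K" "a \<noteq> b" "adj a b" "adj c a" "adj b d" "c \<in> set C" "d \<in> set C" "c \<noteq> d"
    using ear by (auto simp: inner_ear_def ear_def is_path_Cons)
  have xa: "x \<noteq> a" using x adj_vertices by blast
  have "inner_ear c [a, x] d"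
    using ab x xa second_neighbour_attaches[OF assms]
    by (intro inner_earI) (auto simp: is_path_Cons)
  then have Nx: "adj x w \<longleftrightarrow> w = a \<or> w = d" for w
    using short_ear_neighbours[of c a x d b] short ab x(3) by blast
  have Nb: "adj b w \<longleftrightarrow> w = a \<or> w = d" for w
    using short_ear_neighbours[OF assms] .
  have "b \<in> V" "x \<in> V" "x \<notin> set C" using ab x K_subset by auto
  then show False
    using no_twins[of b x] Nx Nb x(3) xa ab by metis
qed

text \<open>
  If the ear has just two vertices, then the component, having a third one, branches off at one of
  them; reversing the ear if necessary, the branch is at its first vertex.
\<close>
lemma ear_of_length_3:
  assumes ear: "inner_ear c q d" "2 \<le> length q"
  obtains p where "inner_ear c p d" "length p = 3"
proof (cases "\<exists>p. inner_ear c p d \<and> 3 \<le> length p")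
  case True
  then show ?thesis using that inner_ear_length(1) by (meson le_antisym)
next
  case False
  then have short: "length p \<le> 2" if "inner_ear c p d" for p using that by force
  then have "length q = 2" using ear by force
  then obtain a b where q: "q = [a, b]" by (auto simp: length_Suc_conv eval_nat_numeral)
  have ab: "a \<in> K" "b \<in> K" "adj a b" using ear(1) q by (auto simp: inner_ear_def ear_def is_path_Cons)
  have "\<exists>y\<in>K. y \<notin> {a, b} \<and> (adj a y \<or> adj b y)"
  proof -
    have "\<not> K \<subseteq> {a, b}"
    proof
      assume "K \<subseteq> {a, b}"
      then have "card K \<le> card {a, b}" by (rule card_mono[rotated]) simp
      also have "\<dots> \<le> 2" by (simp add: card_insert_if)
      finally show False using card_K by simp
    qed
    then obtain z where z: "z \<in> K" "z \<notin> {a, b}" by blast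
    obtain p where p: "is_path E p" "p \<noteq> []" "hd p = a" "last p = z" "set p \<subseteq> K"
      using path_in_K[OF ab(1) z(1)] by blast
    obtain p1 u p2 where s: "p = p1 @ u # p2" "u \<in> {a, b}" "\<forall>v\<in>set p2. v \<notin> {a, b}"
      using split_list_last_prop[of p "\<lambda>v. v \<in> {a, b}"] p by (metis hd_in_set insertI1)
    then have "p2 \<noteq> []" using p z by auto
    then show ?thesis
      using p s by (intro bexI[of _ "hd p2"]) (auto simp: is_path_append is_path_Cons)
  qed
  then obtain y where y: "y \<in> K" "y \<noteq> a" "y \<noteq> b" "adj a y \<or> adj b y" by blast
  then have False
  proof (elim disjE)
    assume "adj a y"
    then show False using no_short_ear_with_branch[of c a b d y] ear q short y by blast
  next
    assume by_edge: "adj b y"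
    have "inner_ear d [b, a] c" using inner_ear_rev[OF ear(1)] q by simp
    moreover have "length p \<le> 2" if "inner_ear d p c" for p
      using short[OF inner_ear_rev[OF that]] by simp
    ultimately show False using no_short_ear_with_branch[of d b a c y] y by_edge by blast
  qed
  then show ?thesis ..
qed

lemma disjoint_attachments:
  assumes "a \<in> K" "b \<in> K" "a \<noteq> b" "c \<in> set C" "d \<in> set C" "c \<noteq> d" "adj c a" "adj d b"
  obtains p where "inner_ear c p d" "length p = 3" "antipodal c d"
proof -
  obtain p where p: "is_path E p" "p \<noteq> []" "hd p = a" "last p = b" "set p \<subseteq> K"
    using path_in_K assms by blast
  then have e: "inner_ear c p d"
    using assms by (intro inner_earI) (auto simp: insert_commute)
  have "2 \<le> length p" using p assms(3) by (cases p; cases "tl p") auto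
  then obtain q where "inner_ear c q d" "length q = 3" using ear_of_length_3 e by blast
  then show ?thesis using that inner_ear_length(2) by fastforce
qed

text \<open>
  If all edges between \<open>K\<close> and \<open>C\<close> met pairwise, they would share a vertex, and this vertex would
  separate the graph.
\<close>
lemma ex_disjoint_attachments:
  obtains a b c d where "a \<in> K" "b \<in> K" "a \<noteq> b" "c \<in> set C" "d \<in> set C" "c \<noteq> d" "adj c a" "adj d b"
proof -
  have attach: "\<exists>a\<in>K. \<exists>c\<in>set C. a \<noteq> w \<and> c \<noteq> w \<and> adj c a" if w: "w \<in> V" for w
  proof -
    have "\<not> K \<subseteq> {w}"
    proof
      assume "K \<subseteq> {w}"
      then have "card K \<le> card {w}" by (rule card_mono[rotated]) simp
      then show False using card_K by simp
    qed
    then obtain x where x: "x \<in> K" "x \<noteq> w" by blast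
    obtain p d where "p \<noteq> []" "set p \<subseteq> K - {w}" "d \<in> set C" "d \<noteq> w" "adj (last p) d"
      using escape[OF x w] by metis
    moreover from this have "last p \<in> K" "last p \<noteq> w" using last_in_set by blast+
    ultimately show ?thesis using adj_commute by blast
  qed
  obtain x where "x \<in> K" using card_K by fastforce
  then obtain a c where a: "a \<in> K" "c \<in> set C" "adj c a" using attach[of x] K_subset by blast
  obtain b d where b: "b \<in> K" "d \<in> set C" "b \<noteq> a" "adj d b" using attach[of a] a K_subset by blast
  show ?thesis
  proof (cases "c = d")
    case False
    then show ?thesis using that a b by blast
  next
    case True
    obtain x e where e: "x \<in> K" "e \<in> set C" "e \<noteq> c" "adj e x"
      using attach[of c] a set_C_subset by blast
    then show ?thesis using that[of a x c e] that[of b x c e] a b True by metis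
  qed
qed

text \<open>Here \<open>c\<close> and \<open>d\<close> are the only vertices through which \<open>K\<close> can be left.\<close>
definition separated_by :: "'a \<Rightarrow> 'a \<Rightarrow> bool" where
  "separated_by c d \<longleftrightarrow> (\<forall>k\<in>K. \<forall>y. adj k y \<longrightarrow> y \<in> K \<union> {c, d})"

lemma separated_byD: "separated_by c d \<Longrightarrow> k \<in> K \<Longrightarrow> adj k y \<Longrightarrow> y \<in> K \<union> {c, d}"
  by (simp add: separated_by_def)

text \<open>
  Given disjoint edges \<open>ca\<close> and \<open>db\<close>, an edge from \<open>k \<in> K\<close> to a third vertex \<open>y\<close> of \<open>C\<close> can
  be disjoint from neither of them, as a vertex has only one antipode. Then \<open>k\<close> would be both \<open>a\<close>
  and \<open>b\<close>.
\<close>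
lemma antipodal_attachments:
  obtains c d p where "antipodal c d" "inner_ear c p d" "length p = 3"
    "separated_by c d"
proof -
  obtain a b c d where m: "a \<in> K" "b \<in> K" "a \<noteq> b" "c \<in> set C" "d \<in> set C" "c \<noteq> d"
    "adj c a" "adj d b" using ex_disjoint_attachments by metis
  obtain p where p: "inner_ear c p d" "length p = 3" "antipodal c d"
    using disjoint_attachments[OF m] by blast
  have unique: "v = w" if "antipodal u v" "antipodal u w" for u v w
  proof -
    have "u \<in> set C"
      using that(1) length_C unfolding antipodal_on_def
      by (metis insertI1 insertE mod_less_divisor nth_mem singletonD zero_less_numeral)
    then obtain d1 d2 d3 d4 d5 where D: "is_cycle E [u, d1, d2, d3, d4, d5]"
      "\<And>x y. antipodal x y \<longleftrightarrow> {x, y} \<in> {{u, d3}, {d1, d4}, {d2, d5}}"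
      using six_cycle_from[OF cycle_C length_C] by metis
    show ?thesis using that D(1) unfolding D(2)
      by (auto simp: is_cycle_path is_path_Cons doubleton_eq_iff)
  qed
  have "y \<in> K \<union> {c, d}" if k: "k \<in> K" "adj k y" for k y
  proof (rule ccontr)
    assume n: "y \<notin> K \<union> {c, d}"
    then have y: "y \<in> set C" "adj y k" using K_closed k adj_commute by blast+
    have "k = a"
    proof (rule ccontr)
      assume "k \<noteq> a"
      then have "antipodal c y" using disjoint_attachments[of a k c y] m y k n by blast
      then show False using unique p(3) n by blast
    qed
    have "k = b"
    proof (rule ccontr)
      assume "k \<noteq> b"
      then have "antipodal d y" using disjoint_attachments[of b k d y] m y k n by blast
      then show False using unique p(3) n antipodal_commute by blast
    qed
    then show False using \<open>k = a\<close> m by blast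
  qed
  then have "separated_by c d" by (simp add: separated_by_def)
  then show ?thesis using that p by blast
qed

lemma path_stays_in_K:
  assumes sep: "separated_by c d"
    and "is_path E q" "set q \<inter> {c, d} = {}" "set q \<inter> K \<noteq> {}"
  shows "set q \<subseteq> K"
  using assms(2-4)
proof (induction q)
  case (Cons x r)
  show ?case
  proof (cases "r = []")
    case False
    then have r: "adj x (hd r)" "is_path E r" "hd r \<in> set r"
      using Cons by (auto simp: is_path_Cons)
    have "x \<in> K \<longleftrightarrow> hd r \<in> K"
      using separated_byD[OF sep, of x "hd r"] separated_byD[OF sep, of "hd r" x] r Cons(3) adj_commute by auto
    then have "set r \<inter> K \<noteq> {}" using Cons(4) r by auto
    then have "set r \<subseteq> K" using Cons r by simp
    then show ?thesis using \<open>x \<in> K \<longleftrightarrow> hd r \<in> K\<close> r by auto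
  qed (use Cons in auto)
qed simp

text \<open>
  Otherwise a path on nine vertices runs from \<open>c\<close> to \<open>d\<close>. Its seven inner vertices are too many for
  an ear in \<open>K\<close>; outside \<open>K\<close>, they form with the ear \<open>p\<close> a cycle of length \<open>7 + 3 + 2 = 12\<close>.
\<close>
lemma attachments_adjacent:
  assumes ear: "inner_ear c p d" "length p = 3"
    and sep: "separated_by c d"
  shows "adj c d"
proof (rule ccontr)
  assume "\<not> adj c d"
  have cd: "c \<in> set C" "d \<in> set C" "c \<noteq> d" using ear by (auto simp: inner_ear_def ear_def)
  then obtain xs where xs: "is_path E xs" "length xs = 9" "hd xs = c" "last xs = d"
    using path9_exists[of c d] set_C_subset \<open>\<not> adj c d\<close> by blast
  obtain q where "xs = hd xs # q @ [last xs]" "length q = 7"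
    using split_off_ends[of xs 7] xs(2) by auto
  then have q: "xs = c # q @ [d]" "length q = 7" "q \<noteq> []"
    using xs by auto
  have p: "is_path E q" "c \<notin> set q" "d \<notin> set q" "adj c (hd q)" "adj (last q) d"
    using xs(1) q by (auto simp: is_path_Cons is_path_append)
  show False
  proof (cases "set q \<inter> K = {}")
    case True
    then show False
      using two_ears_length[of c p d q] ear p q unfolding inner_ear_def by auto
  next
    case False
    then have "set q \<subseteq> K" using path_stays_in_K[OF sep] p by blast
    then have "inner_ear c q d" using p q cd by (intro inner_earI)
    then show False using inner_ear_length(1) q by fastforce
  qed
qed

text \<open>
  Leaves are told apart by which of \<open>c\<close> and \<open>d\<close> they are adjacent to, as they would be twins
  otherwise. With three leaves all three possibilities occur, and there is no room for a fourth leaf.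
  The path on nine vertices between the leaves \<open>l1\<close> and \<open>l2\<close> that see one of \<open>c\<close> and \<open>d\<close> each has
  too many vertices for \<open>K \<union> {c, d}\<close>, so that it splits into stretches \<open>A\<close> and \<open>B\<close> in \<open>K\<close> and
  a stretch \<open>Q\<close> outside \<open>K\<close>, separated by \<open>c\<close> and \<open>d\<close>. As \<open>A\<close> and \<open>B\<close> have between 2 and 4
  vertices in all, \<open>Q\<close> has between 3 and 5.
\<close>
lemma not_star:
  assumes m: "3 \<le> m" and star: "is_star m K (induced_edges E K)"
  shows False
proof -
  obtain z L where K: "K = insert z L" and zL: "z \<notin> L" and L: "finite L" "card L = m"
    and edges: "induced_edges E K = {{z, l} | l. l \<in> L}"
    using star unfolding is_star_def by blast
  obtain c d p where ear: "antipodal c d" "inner_ear c p d" "length p = 3"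
    and sep: "separated_by c d"
    using antipodal_attachments by metis
  have cd: "c \<in> set C" "d \<in> set C" "c \<noteq> d" "c \<notin> K" "d \<notin> K"
    using ear K_subset by (auto simp: inner_ear_def ear_def)
  have zl: "adj z l" if "l \<in> L" for l
    using edges that unfolding induced_edges_def by blast
  have ll: "y = z" if l: "l \<in> L" and y: "y \<in> K" and "adj l y" for l y
  proof -
    have "{l, y} \<in> induced_edges E K" using that K by (auto simp: induced_edges_def)
    then obtain l' where "{l, y} = {z, l'}" using edges by blast
    then show ?thesis using zL l by (auto simp: doubleton_eq_iff)
  qed
  have leaf: "adj l c \<or> adj l d" if l: "l \<in> L" for l
  proof -
    have "l \<in> K" "l \<noteq> z" "z \<in> V" using l K zL K_subset by auto
    then obtain q e where q: "is_path E q" "q \<noteq> []" "hd q = l" "set q \<subseteq> K - {z}"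
      "e \<in> set C" "adj (last q) e" using escape by metis
    obtain r where r: "q = l # r" using q by (cases q) auto
    have "r = []"
    proof (rule ccontr)
      assume "r \<noteq> []"
      then have "hd r \<in> set r" by simp
      then have "hd r = z" using ll[OF l, of "hd r"] q r by (auto simp: is_path_Cons)
      then show False using q(4) r \<open>hd r \<in> set r\<close> by auto
    qed
    then have "adj l e" using q r by simp
    moreover have "e \<notin> K" using q K_subset by blast
    ultimately show ?thesis using separated_byD[OF sep, of l e] \<open>l \<in> K\<close> by auto
  qed
  have nbr: "adj l w \<longleftrightarrow> w = z \<or> (w = c \<and> adj l c) \<or> (w = d \<and> adj l d)" if l: "l \<in> L" for l w
  proof
    assume w: "adj l w"
    then have "w \<in> K \<union> {c, d}" using separated_byD[OF sep, of l w] l K by simp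
    then show "w = z \<or> (w = c \<and> adj l c) \<or> (w = d \<and> adj l d)" using ll[OF l _ w] w by auto
  next
    assume "w = z \<or> (w = c \<and> adj l c) \<or> (w = d \<and> adj l d)"
    then show "adj l w" using zl[OF l] adj_commute[of z l] by auto
  qed
  let ?f = "\<lambda>l. (adj l c, adj l d)"
  have inj: "inj_on ?f L"
  proof (rule inj_onI)
    fix l l' assume l: "l \<in> L" "l' \<in> L" "?f l = ?f l'"
    show "l = l'"
    proof (rule ccontr)
      assume "l \<noteq> l'"
      moreover have "adj l w \<longleftrightarrow> adj l' w" for w
        using nbr[OF l(1), of w] nbr[OF l(2), of w] l(3) by simp
      moreover have "\<not> adj l l'" using ll[of l l'] l K zL by blast
      ultimately show False using no_twins[of l l'] l K K_subset by blast
    qed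
  qed
  have sub: "?f ` L \<subseteq> {(True, False), (False, True), (True, True)}"
    using leaf by auto
  have "card (?f ` L) = m" using inj L by (simp add: card_image)
  moreover have "card {(True, False), (False, True), (True, True)} = 3" by simp
  ultimately have img: "?f ` L = {(True, False), (False, True), (True, True)}"
    using sub m by (intro card_seteq) auto
  then have "card L = 3" using card_image[OF inj] by simp
  then have card4: "card K = 4" "finite K" using K zL L by auto
  obtain l1 where l1: "l1 \<in> L" "adj l1 c" "\<not> adj l1 d"
    using img by (smt (verit) image_iff insertI1 prod.inject)
  obtain l2 where l2: "l2 \<in> L" "\<not> adj l2 c" "adj l2 d"
    using img by (smt (verit) image_iff insertI1 insertI2 prod.inject)
  have p: "ear c p d" "set p \<subseteq> K" using ear by (auto simp: inner_ear_def)
  have no_bypass: "length Q \<notin> {3, 4, 5}"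
    if Q: "Q \<noteq> []" "is_path E Q" "set Q \<inter> (K \<union> {c, d}) = {}" "adj c (hd Q)" "adj (last Q) d" for Q
    using two_ears_length[OF p(1) Q(1,2,4,5)] Q(3) p(2) ear(3) by auto
  have lK: "l1 \<in> K" "l2 \<in> K" using l1 l2 K by auto
  have "l1 \<noteq> l2" using l1 l2 by blast
  moreover have "\<not> adj l1 l2" using ll[of l1 l2] l1 l2 K zL by blast
  ultimately obtain xs where xs: "is_path E xs" "length xs = 9" "hd xs = l1" "last xs = l2"
    using path9_exists[of l1 l2] lK K_subset by blast
  have dist: "distinct xs" "card (set xs) = 9" using xs by (auto simp: is_path_def distinct_card)
  have "\<not> set xs \<subseteq> K \<union> {c, d}"
  proof
    assume "set xs \<subseteq> K \<union> {c, d}"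
    then have "card (set xs) \<le> card (K \<union> {c, d})" using card4 by (intro card_mono) auto
    also have "\<dots> \<le> card K + card {c, d}" by (rule card_Un_le)
    also have "\<dots> \<le> 6" using card4 by (simp add: card_insert_if)
    finally show False using dist by simp
  qed
  then obtain v where v: "v \<in> set xs" "v \<notin> K \<union> {c, d}" by blast
  then obtain P S where PS: "xs = P @ v # S" by (meson split_list)
  have ne: "P \<noteq> []" "S \<noteq> []" using PS xs v lK by auto
  have ends: "l1 \<in> set P" "l2 \<in> set S" "hd P = l1" "last S = l2"
    using PS xs ne by auto
  have paths: "is_path E (P @ [v])" "is_path E (v # S)"
    using xs PS by (auto simp: is_path_append is_path_Cons)
  \<comment> \<open>Let \<open>u\<close> be the last of \<open>c, d\<close> before \<open>v\<close> and \<open>u'\<close> the first one after it. They exist, for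
    both ends of the path lie in \<open>K\<close>, and they differ, so nothing before \<open>u\<close> or after \<open>u'\<close> leaves \<open>K\<close>.\<close>
  have "set (P @ [v]) \<inter> {c, d} \<noteq> {}"
    using path_stays_in_K[OF sep paths(1)] v ends lK by auto
  then have "\<exists>u\<in>set P. u \<in> {c, d}" using v by auto
  then obtain A u Q1 where P: "P = A @ u # Q1" "u \<in> {c, d}" "\<forall>y\<in>set Q1. y \<notin> {c, d}"
    using split_list_last_prop[of P "\<lambda>u. u \<in> {c, d}"] by metis
  have "set (v # S) \<inter> {c, d} \<noteq> {}"
    using path_stays_in_K[OF sep paths(2)] v ends lK by auto
  then have "\<exists>u\<in>set S. u \<in> {c, d}" using v by auto
  then obtain Q2 u' B where S: "S = Q2 @ u' # B" "u' \<in> {c, d}" "\<forall>y\<in>set Q2. y \<notin> {c, d}"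
    using split_list_first_prop[of S "\<lambda>u. u \<in> {c, d}"] by metis
  define Q where "Q = Q1 @ v # Q2"
  have X: "xs = A @ u # Q @ u' # B" using PS P S by (simp add: Q_def)
  then have uu: "{u, u'} = {c, d}" using P S dist by auto
  have Qne: "Q \<noteq> []" "v \<in> set Q" by (simp_all add: Q_def)
  have pathX: "is_path E (A @ u # Q @ u' # B)" using xs(1) X by simp
  have pathsX: "is_path E A" "is_path E Q" "is_path E B" "adj u (hd Q)" "adj (last Q) u'"
    using pathX Qne by (simp_all add: is_path_append is_path_Cons)
  have "A \<noteq> []" "B \<noteq> []" using X xs P S lK cd by auto
  then have "l1 \<in> set A" "l2 \<in> set B" using X xs by auto
  have disj: "set A \<inter> {u, u'} = {}" "set B \<inter> {u, u'} = {}" "set Q \<inter> {u, u'} = {}"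
    using dist(1) unfolding X by auto
  have AB: "set A \<subseteq> K" "set B \<subseteq> K"
    using path_stays_in_K[OF sep pathsX(1)] path_stays_in_K[OF sep pathsX(3)] disj uu
      \<open>l1 \<in> set A\<close> \<open>l2 \<in> set B\<close> lK by auto
  have QK: "set Q \<inter> K = {}"
    using path_stays_in_K[OF sep pathsX(2)] disj uu v Qne by auto
  have "length A + length B = card (set A \<union> set B)"
    using dist(1) unfolding X by (subst card_Un_disjoint) (auto simp: distinct_card)
  also have "\<dots> \<le> 4" using card_mono[of K "set A \<union> set B"] AB card4 by auto
  finally have "length A + length B \<le> 4" .
  moreover have "length A + length B + length Q = 7" using xs(2) X by simp
  moreover have "length A \<ge> 1" "length B \<ge> 1" using \<open>A \<noteq> []\<close> \<open>B \<noteq> []\<close> by (auto simp: Suc_le_eq)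
  ultimately have "length Q \<in> {3, 4, 5}" by auto
  moreover have "length Q \<notin> {3, 4, 5}"
  proof (cases "u = c")
    case True
    then have "u' = d" using uu cd by (auto simp: doubleton_eq_iff)
    then show ?thesis using no_bypass[of Q] True pathsX QK disj uu Qne by auto
  next
    case False
    then have "u = d" "u' = c" using uu P(2) by (auto simp: doubleton_eq_iff)
    then have "length (rev Q) \<notin> {3, 4, 5}"
      using pathsX QK disj uu Qne adj_commute
      by (intro no_bypass) (auto simp: hd_rev last_rev)
    then show ?thesis by simp
  qed
  ultimately show False by blast
qed

end


theorem lemma6p6:
  fixes V R :: "'a set" and E :: "'a set set" and C :: "'a list"
  assumes "simple_graph V E"
    and "two_connected V E"
    and "uniquely_cycle_saturated 9 V E"
    and "9 \<le> card V"
    and "longest_even_cycle_upto 12 E C"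
    and "length C = 6"
    and "R = V - set C"
  shows "(\<forall>K. is_component R (induced_edges E R) K \<and> 3 \<le> card K \<longrightarrow>
            (\<exists>a<6. attachment_vertices E C K \<subseteq> {C ! a, C ! ((a + 3) mod 6)} \<and>
                   {C ! a, C ! ((a + 3) mod 6)} \<in> E)) \<and>
         (\<forall>K m. is_component R (induced_edges E R) K \<and> 3 \<le> m \<longrightarrow>
            \<not> is_star m K (induced_edges E K))"
proof -
  interpret saturated_with_six_cycle V E C
    using assms by unfold_locales
  show ?thesis
  proof (intro conjI allI impI)
    fix K assume "is_component R (induced_edges E R) K \<and> 3 \<le> card K"
    then interpret large_component V E C K
      using assms(7) by unfold_locales auto
    obtain c d p where ear: "antipodal c d" "inner_ear c p d" "length p = 3"
      and sep: "separated_by c d"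
      using antipodal_attachments by metis
    have "adj c d" using attachments_adjacent[OF ear(2,3) sep] .
    moreover have "attachment_vertices E C K \<subseteq> {c, d}"
      using separated_byD[OF sep] adj_commute K_subset unfolding attachment_vertices_def by blast
    ultimately show "\<exists>a<6. attachment_vertices E C K \<subseteq> {C ! a, C ! ((a + 3) mod 6)} \<and>
                   {C ! a, C ! ((a + 3) mod 6)} \<in> E"
      using ear(1) unfolding antipodal_on_def by metis
  next
    fix K and m :: nat assume K: "is_component R (induced_edges E R) K \<and> 3 \<le> m"
    show "\<not> is_star m K (induced_edges E K)"
    proof
      assume star: "is_star m K (induced_edges E K)"
      then have "3 \<le> card K"
        using K unfolding is_star_def by auto
      then interpret large_component V E C K
        using assms(7) K by unfold_locales auto
      show False using not_star star K by blast
    qed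
  qed
qed

end
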